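(* Let $\Phi=(\phi_n)$, $\Psi=(\psi_n)$ be sequences in $\mathcal H$ and $m=(m_n)$ a complex scalar sequence. The following statements hold. (i) Let $\Phi$ be an $NBB$ Bessel sequence for $\mathcal H$. Then $M_{m,\Phi,\Psi}$ is unconditionally convergent on $\mathcal H$ if and only if $m\Psi$ is Bessel for $\mathcal H$. (ii) Let $\Phi$ be a Riesz basis for $\mathcal H$. Then the following are equivalent: $M_{m,\Phi,\Psi}$ is well defined on $\mathcal H$; $M_{m,\Phi,\Psi}$ is unconditionally convergent on $\mathcal H$; $m\Psi$ is Bessel for $\mathcal H$; $M_{m,\Psi,\Phi}$ is well defined on $\mathcal H$; $M_{m,\Psi,\Phi}$ is unconditionally convergent on $\mathcal H$. (iii) Let $\Phi$ be a Riesz basis for $\mathcal H$ and $\Psi$ be $NBB$. If $M_{m,\Phi,\Psi}$ (or $M_{m,\Psi,\Phi}$) is well defined on $\mathcal H$, then $m\in\ell^\infty$. The converse does not hold in general, i.e. there exist a Riesz basis $\Phi$, an $NBB$ sequence $\Psi$ and $m\in\ell^\infty$ for which neither $M_{m,\Phi,\Psi}$ nor $M_{m,\Psi,\Phi}$ is well defined on $\mathcal H$. (iv) If $\Phi$ and $\Psi$ are Riesz bases for $\mathcal H$, then $M_{m,\Phi,\Psi}$ is well defined on $\mathcal H$ if and only if $m\in\ell^\infty$.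
   Context: $\mathcal H$ is a separable infinite-dimensional complex Hilbert space, inner product linear in the first argument; all sequences are indexed by $\mathbb N$. The multiplier is $M_{m,\Phi,\Psi}f=\sum_n m_n\langle f,\psi_n\rangle\phi_n$; it is well defined on $\mathcal H$ if the series converges for every $f\in\mathcal H$, and unconditionally convergent on $\mathcal H$ if the series converges unconditionally (i.e. every permutation of it converges) for every $f\in\mathcal H$. Notation: $m\Psi=(m_n\psi_n)$. $\Phi$ is Bessel for $\mathcal H$ if there is $B>0$ with $\sum|\langle h,\phi_n\rangle|^2\le B\|h\|^2$ for all $h\in\mathcal H$. A Riesz basis for $\mathcal H$ is a complete sequence in $\mathcal H$ (closed linear span equal to $\mathcal H$) with $A\sum|c_n|^2\le\|\sum c_n\phi_n\|^2\le B\sum|c_n|^2$ for all $(c_n)\in\ell^2$, for some $0<A\le B<\infty$. $\Phi$ is $NBB$ (norm-bounded below) if $\inf_n\|\phi_n\|>0$. *)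

theory Defs
  imports "HOL-Analysis.Analysis"
begin

section \<open>Complex Hilbert spaces\<close>

class complex_vector = real_vector +
  fixes scaleC :: "complex \<Rightarrow> 'a \<Rightarrow> 'a"  (infixr \<open>*\<^sub>C\<close> 75)
  assumes scaleC_add_right: "a *\<^sub>C (x + y) = a *\<^sub>C x + a *\<^sub>C y"
    and scaleC_add_left: "(a + b) *\<^sub>C x = a *\<^sub>C x + b *\<^sub>C x"
    and scaleC_scaleC: "a *\<^sub>C b *\<^sub>C x = (a * b) *\<^sub>C x"
    and scaleC_one: "1 *\<^sub>C x = x"
    and scaleR_scaleC: "r *\<^sub>R x = complex_of_real r *\<^sub>C x"

text \<open>The inner product is linear in the first argument. Positive definiteness is part of
  \<open>norm_eq_sqrt_cinner\<close>, since the norm is a norm; see \<open>cinner_self\<close> below.\<close>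

class complex_inner = complex_vector + real_normed_vector +
  fixes cinner :: "'a \<Rightarrow> 'a \<Rightarrow> complex"
  assumes cinner_add_left: "cinner (x + y) z = cinner x z + cinner y z"
    and cinner_scaleC_left: "cinner (a *\<^sub>C x) y = a * cinner x y"
    and cinner_commute: "cinner x y = cnj (cinner y x)"
    and norm_eq_sqrt_cinner: "norm x = sqrt (Re (cinner x x))"

class chilbert_space = complex_inner + complete_space

global_interpretation complex_vector:
  vector_space "scaleC :: complex \<Rightarrow> 'a \<Rightarrow> 'a::complex_vector"
  defines cspan_raw_def: cspan = complex_vector.span
  by unfold_locales (auto simp: scaleC_add_right scaleC_add_left scaleC_scaleC scaleC_one)

lemma cinner_self: "cinner x x = complex_of_real ((norm x)\<^sup>2)"
proof -
  have "0 \<le> Re (cinner x x)"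
    using norm_ge_zero[of x] by (simp add: norm_eq_sqrt_cinner)
  moreover have "Im (cinner x x) = 0"
    using arg_cong[OF cinner_commute[of x x], of Im] by simp
  ultimately show ?thesis
    by (simp add: complex_eq_iff norm_eq_sqrt_cinner)
qed


section \<open>Bessel sequences, Riesz bases and multipliers\<close>

definition bessel :: "(nat \<Rightarrow> 'a::chilbert_space) \<Rightarrow> bool" where
  "bessel \<Phi> \<longleftrightarrow> (\<exists>B>0. \<forall>h. summable (\<lambda>n. (cmod (cinner h (\<Phi> n)))\<^sup>2) \<and>
     (\<Sum>n. (cmod (cinner h (\<Phi> n)))\<^sup>2) \<le> B * (norm h)\<^sup>2)"

definition norm_bounded_below :: "(nat \<Rightarrow> 'a::chilbert_space) \<Rightarrow> bool" where
  "norm_bounded_below \<Phi> \<longleftrightarrow> (INF n. norm (\<Phi> n)) > 0"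

text \<open>Convergence of \<open>\<Sum>n. c n *\<^sub>C \<Phi> n\<close> for square-summable \<open>c\<close> is implicit in the
  two-sided inequality, hence the \<open>summable\<close> conjunct (\<open>suminf\<close> is total).\<close>

definition riesz_basis :: "(nat \<Rightarrow> 'a::chilbert_space) \<Rightarrow> bool" where
  "riesz_basis \<Phi> \<longleftrightarrow> closure (cspan (range \<Phi>)) = UNIV \<and>
     (\<exists>A B. 0 < A \<and> A \<le> B \<and>
       (\<forall>c :: nat \<Rightarrow> complex. summable (\<lambda>n. (cmod (c n))\<^sup>2) \<longrightarrow>
          summable (\<lambda>n. c n *\<^sub>C \<Phi> n) \<and>
          A * (\<Sum>n. (cmod (c n))\<^sup>2) \<le> (norm (\<Sum>n. c n *\<^sub>C \<Phi> n))\<^sup>2 \<and>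
          (norm (\<Sum>n. c n *\<^sub>C \<Phi> n))\<^sup>2 \<le> B * (\<Sum>n. (cmod (c n))\<^sup>2)))"

text \<open>The terms of the series defining \<open>M\<^bsub>m,\<Phi>,\<Psi>\<^esub> f\<close>.\<close>

definition multiplier_term ::
    "(nat \<Rightarrow> complex) \<Rightarrow> (nat \<Rightarrow> 'a::chilbert_space) \<Rightarrow> (nat \<Rightarrow> 'a) \<Rightarrow> 'a \<Rightarrow> nat \<Rightarrow> 'a" where
  "multiplier_term m \<Phi> \<Psi> f n = (m n * cinner f (\<Psi> n)) *\<^sub>C \<Phi> n"

definition multiplier_well_defined ::
    "(nat \<Rightarrow> complex) \<Rightarrow> (nat \<Rightarrow> 'a::chilbert_space) \<Rightarrow> (nat \<Rightarrow> 'a) \<Rightarrow> bool" where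
  "multiplier_well_defined m \<Phi> \<Psi> \<longleftrightarrow> (\<forall>f. summable (multiplier_term m \<Phi> \<Psi> f))"

definition multiplier_unconditionally_convergent ::
    "(nat \<Rightarrow> complex) \<Rightarrow> (nat \<Rightarrow> 'a::chilbert_space) \<Rightarrow> (nat \<Rightarrow> 'a) \<Rightarrow> bool" where
  "multiplier_unconditionally_convergent m \<Phi> \<Psi> \<longleftrightarrow>
     (\<forall>f. \<forall>\<pi>. bij \<pi> \<longrightarrow> summable (\<lambda>n. multiplier_term m \<Phi> \<Psi> f (\<pi> n)))"

end

(*
  A seminorm version of the uniform boundedness principle shows that a sequence (xi_n) is Bessel
  as soon as (<h, xi_n>)_n is square summable for every h. Unconditional convergence of
  M_{m,Phi,Psi} gives this for m Psi by Orlicz's theorem if Phi is norm-bounded below; for a Riesz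
  basis Phi, plain convergence suffices because of the lower Riesz bound. Convergence of
  M_{m,Psi,Phi} is dualised: uniform boundedness bounds the vectors sum_{n<N} <h, m_n psi_n> phi_n.
  The converses hold since a square-summable sequence can be synthesised along any permutation of
  a Bessel sequence. For the counterexample in (iii), m = 1, Phi is an orthonormal basis and Psi
  is constant, so that m Psi is not Bessel.
*)

theory Submission
  imports Defs
begin

subsection \<open>Inner products\<close>

instance chilbert_space \<subseteq> banach ..

lemma cinner_add_right: "cinner x (y + z) = cinner x y + cinner x z"
  by (metis cinner_add_left cinner_commute complex_cnj_add)

lemma cinner_scaleC_right: "cinner x (a *\<^sub>C y) = cnj a * cinner x y"
  by (metis cinner_scaleC_left cinner_commute complex_cnj_mult)

lemma cinner_zero_left [simp]: "cinner 0 y = 0"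
  by (metis add_cancel_right_left cinner_add_left)

lemma cinner_zero_right [simp]: "cinner x 0 = 0"
  by (metis cinner_commute cinner_zero_left complex_cnj_zero)

lemma cinner_minus_left: "cinner (- x) y = - cinner x y"
  by (metis add.right_inverse cinner_add_left cinner_zero_left minus_unique)

lemma cinner_diff_left: "cinner (x - y) z = cinner x z - cinner y z"
  by (metis add_uminus_conv_diff cinner_add_left cinner_minus_left)

lemma cinner_sum_left: "cinner (\<Sum>i\<in>I. f i) y = (\<Sum>i\<in>I. cinner (f i) y)"
  by (induction I rule: infinite_finite_induct) (auto simp: cinner_add_left)

lemma cinner_sum_right: "cinner x (\<Sum>i\<in>I. f i) = (\<Sum>i\<in>I. cinner x (f i))"
  by (induction I rule: infinite_finite_induct) (auto simp: cinner_add_right)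

text \<open>The class axioms give homogeneity of the norm for real scalars; for complex ones it is
  read off from \<open>cinner (a *\<^sub>C x) (a *\<^sub>C x)\<close>.\<close>

lemma norm_scaleC: "norm (a *\<^sub>C x) = cmod a * norm (x :: 'a::complex_inner)"
proof -
  have "complex_of_real ((norm (a *\<^sub>C x))\<^sup>2) = a * cnj a * cinner x x"
    by (simp only: cinner_self [symmetric] cinner_scaleC_left cinner_scaleC_right ac_simps)
  also have "\<dots> = complex_of_real ((cmod a * norm x)\<^sup>2)"
    by (simp add: cinner_self complex_norm_square [symmetric] power_mult_distrib)
  finally have "(norm (a *\<^sub>C x))\<^sup>2 = (cmod a * norm x)\<^sup>2"
    using of_real_eq_iff by blast
  then show ?thesis
    by (simp add: power2_eq_iff_nonneg)
qed

lemma cinner_scaleR_left: "cinner (r *\<^sub>R x) y = complex_of_real r * cinner x y"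
  for x :: "'a::complex_inner"
  by (simp add: scaleR_scaleC cinner_scaleC_left)

lemma norm_add_sq: "(norm (x + y))\<^sup>2 = (norm x)\<^sup>2 + (norm y)\<^sup>2 + 2 * Re (cinner x y)"
  for x :: "'a::complex_inner"
proof -
  have "complex_of_real ((norm (x + y))\<^sup>2) = cinner x x + cinner y y + (cinner x y + cnj (cinner x y))"
    by (simp only: cinner_self [symmetric] cinner_add_left cinner_add_right
        cinner_commute [of y x, symmetric] ac_simps)
  also have "\<dots> = complex_of_real ((norm x)\<^sup>2 + (norm y)\<^sup>2 + 2 * Re (cinner x y))"
    by (simp add: cinner_self complex_add_cnj)
  finally show ?thesis
    using of_real_eq_iff by blast
qed

lemma cinner_Cauchy_Schwarz: "cmod (cinner x y) \<le> norm x * norm y"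
  for x :: "'a::complex_inner"
proof (cases "y = 0")
  case False
  \<comment> \<open>\<open>t *\<^sub>C y\<close> is minus the orthogonal projection of
    \<open>x\<close> onto the line through \<open>y\<close>. The inequality becomes nonnegativity of
    the squared norm of the residual \<open>x + t *\<^sub>C y\<close>.\<close>
  define t where "t = - cinner x y / complex_of_real ((norm y)\<^sup>2)"
  have ny: "(norm y)\<^sup>2 > 0"
    using False by simp
  have "cinner x (t *\<^sub>C y) = - complex_of_real ((cmod (cinner x y))\<^sup>2 / (norm y)\<^sup>2)"
    unfolding cinner_scaleC_right t_def
    by (simp add: complex_norm_square [symmetric] mult.commute [of "cnj _"])
  then have "Re (cinner x (t *\<^sub>C y)) = - ((cmod (cinner x y))\<^sup>2 / (norm y)\<^sup>2)"
    by (metis Re_complex_of_real of_real_minus)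
  moreover have "(norm (t *\<^sub>C y))\<^sup>2 = (cmod (cinner x y))\<^sup>2 / (norm y)\<^sup>2"
    using ny by (simp add: norm_scaleC t_def norm_divide norm_power norm_mult field_simps power2_eq_square)
  ultimately have "(norm (x + t *\<^sub>C y))\<^sup>2 = (norm x)\<^sup>2 - (cmod (cinner x y))\<^sup>2 / (norm y)\<^sup>2"
    by (simp add: norm_add_sq)
  then have "(cmod (cinner x y))\<^sup>2 / (norm y)\<^sup>2 \<le> (norm x)\<^sup>2"
    by (metis diff_ge_0_iff_ge zero_le_power2)
  then have "(cmod (cinner x y))\<^sup>2 \<le> (norm x * norm y)\<^sup>2"
    using ny by (simp add: divide_le_eq power_mult_distrib)
  then show ?thesis
    by (simp add: power2_le_iff_abs_le)
qed simp

lemma bounded_linear_cinner_left: "bounded_linear (\<lambda>x. cinner x y)"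
  for y :: "'a::complex_inner"
  by (rule bounded_linear_intro[of _ "norm y"])
    (auto simp: cinner_add_left cinner_scaleR_left scaleR_conv_of_real cinner_Cauchy_Schwarz)

lemmas continuous_on_cinner_left [continuous_intros] =
  bounded_linear.continuous_on[OF bounded_linear_cinner_left]

subsection \<open>Uniform boundedness\<close>

text \<open>Baire's theorem yields a ball on which all \<open>p N\<close> share a bound, and
  homogeneity spreads it to the whole space. The seminorm form covers both moduli of functionals and
  truncated square-sum norms.\<close>

theorem uniform_boundedness_seminorms:
  fixes p :: "nat \<Rightarrow> 'a::banach \<Rightarrow> real"
  assumes cont: "\<And>N. continuous_on UNIV (p N)"
    and triangle: "\<And>N x y. p N (x - y) \<le> p N x + p N y"
    and scale: "\<And>N r x. p N (r *\<^sub>R x) = \<bar>r\<bar> * p N x"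
    and pointwise: "\<And>x. \<exists>C. \<forall>N. p N x \<le> C"
  obtains C where "0 < C" "\<And>N x. p N x \<le> C * norm x"
proof -
  define F where "F k = {x. \<forall>N. p N x \<le> real k}" for k
  have "F k = (\<Inter>N. {x. p N x \<le> real k})" for k
    by (auto simp: F_def)
  then have closed_F: "closed (F k)" for k
    by (auto intro!: closed_INT closed_Collect_le cont continuous_intros)
  have cover: "(\<Union>k. F k) = UNIV"
  proof -
    have "x \<in> (\<Union>k. F k)" for x
    proof -
      obtain C where "\<forall>N. p N x \<le> C"
        using pointwise by blast
      moreover obtain k where "C \<le> real k"
        using real_arch_simple by blast
      ultimately show ?thesis
        by (auto simp: F_def intro: order_trans)
    qed
    then show ?thesis by auto
  qed
  have "\<exists>k. interior (F k) \<noteq> {}"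
  proof (rule ccontr)
    assume "\<nexists>k. interior (F k) \<noteq> {}"
    then have "euclidean interior_of (\<Union>(range F)) = {}"
      using Met_TC.metric_Baire_category_alt[of "range F"] closed_F
      by (auto simp: complete_UNIV)
    then show False
      using cover by simp
  qed
  then obtain k x r where r: "0 < r" "cball x r \<subseteq> F k"
    by (metis all_not_in_conv mem_interior_cball)
  show thesis
  proof (rule that)
    \<comment> \<open>On vectors of norm \<open>r\<close>, written as differences of two points of
      the ball, \<open>p N\<close> is at most \<open>2 * real k\<close>; the added 1 keeps the
      constant positive when \<open>k = 0\<close>.\<close>
    show "0 < (2 * real k + 1) / r"
      using r by simp
    fix N y
    show "p N y \<le> (2 * real k + 1) / r * norm y"
    proof (cases "y = 0")
      case True
      then show ?thesis
        using scale[of N 0 y] by simp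
    next
      case False
      \<comment> \<open>\<open>s\<close> stretches \<open>y\<close> to length \<open>r\<close>, so
        that \<open>x + s *\<^sub>R y\<close> stays in the ball.\<close>
      define s where "s = r / norm y"
      have s: "s > 0" "norm (s *\<^sub>R y) = r"
        using False r by (auto simp: s_def)
      have "x + s *\<^sub>R y \<in> F k" "x \<in> F k"
        using r s by (auto intro!: subsetD[OF r(2)] simp: dist_norm)
      then have "p N (x + s *\<^sub>R y) \<le> k" "p N x \<le> k"
        by (auto simp: F_def)
      with triangle[of N "x + s *\<^sub>R y" x] have "p N (s *\<^sub>R y) \<le> 2 * k"
        by simp
      then have "s * p N y \<le> 2 * real k + 1"
        using s by (simp add: scale)
      then show ?thesis
        using s False r by (simp add: s_def field_simps)
    qed
  qed
qed

corollary uniform_boundedness_functionals: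
  fixes y :: "nat \<Rightarrow> 'a::chilbert_space"
  assumes "\<And>x. bounded (range (\<lambda>N. cinner x (y N)))"
  shows "bounded (range y)"
proof -
  have pointwise: "\<exists>C. \<forall>N. cmod (cinner x (y N)) \<le> C" for x
    using assms[of x] by (auto simp: bounded_iff)
  obtain C where C: "0 < C" "\<And>N x. cmod (cinner x (y N)) \<le> C * norm x"
    by (rule uniform_boundedness_seminorms[of "\<lambda>N x. cmod (cinner x (y N))"])
      (use pointwise in \<open>auto intro!: continuous_intros
         simp: cinner_diff_left cinner_scaleR_left norm_mult norm_triangle_ineq4\<close>)
  \<comment> \<open>Evaluating the functional at its own representing vector gives
    \<open>(norm (y N))\<^sup>2 \<le> C * norm (y N)\<close>.\<close>
  have "norm (y N) \<le> C" for N
    using C(1) C(2)[of "y N" N]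
    by (cases "y N = 0") (auto simp: cinner_self norm_power norm_mult power2_eq_square)
  then show ?thesis
    by (auto simp: bounded_iff)
qed

subsection \<open>Orlicz's theorem\<close>

text \<open>Signs are chosen greedily, \<open>P\<close> collecting the plus signs: each new term
  gets the sign that makes its cross term with the current sum nonnegative, so the squared norm
  grows by at least \<open>(norm (x a))\<^sup>2\<close>.\<close>

lemma exists_signs_norm_sum_ge:
  fixes x :: "nat \<Rightarrow> 'a::complex_inner"
  assumes "finite G"
  shows "\<exists>P\<subseteq>G. (\<Sum>n\<in>G. (norm (x n))\<^sup>2) \<le> (norm (sum x P - sum x (G - P)))\<^sup>2"
  using assms
proof (induction G)
  case empty
  then show ?case by simp
next
  case (insert a G)
  then obtain P where P: "P \<subseteq> G"
    "(\<Sum>n\<in>G. (norm (x n))\<^sup>2) \<le> (norm (sum x P - sum x (G - P)))\<^sup>2"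
    by blast
  define s where "s = sum x P - sum x (G - P)"
  have fin: "finite P" "finite (G - P)" and a: "a \<notin> P"
    using insert P finite_subset by auto
  show ?case
  proof (cases "Re (cinner s (x a)) \<ge> 0")
    case True
    have "insert a G - insert a P = G - P"
      using insert by auto
    then have "sum x (insert a P) - sum x (insert a G - insert a P) = s + x a"
      using fin a by (simp add: s_def)
    moreover have "(\<Sum>n\<in>insert a G. (norm (x n))\<^sup>2) \<le> (norm (s + x a))\<^sup>2"
      using True insert P by (simp add: norm_add_sq s_def)
    ultimately show ?thesis
      using P by (intro exI[of _ "insert a P"]) auto
  next
    case False
    have "insert a G - P = insert a (G - P)"
      using a by auto
    then have "sum x P - sum x (insert a G - P) = s + - x a"
      using fin insert by (simp add: s_def)
    moreover have "Re (cinner s (- x a)) = - Re (cinner s (x a))"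
      by (metis cinner_commute cinner_minus_left complex_cnj_minus uminus_complex.sel(1))
    then have "(\<Sum>n\<in>insert a G. (norm (x n))\<^sup>2) \<le> (norm (s + - x a))\<^sup>2"
      unfolding norm_add_sq using False insert P by (simp add: s_def)
    ultimately show ?thesis
      using P by (intro exI[of _ P]) auto
  qed
qed

text \<open>By the triangle inequality the heavier of \<open>P\<close> and \<open>G - P\<close>
  carries at least half the norm of the signed sum; hence the factor 2.\<close>

lemma exists_subset_norm_sum_ge:
  fixes x :: "nat \<Rightarrow> 'a::complex_inner"
  assumes "finite G"
  shows "\<exists>F\<subseteq>G. (\<Sum>n\<in>G. (norm (x n))\<^sup>2) \<le> (2 * norm (sum x F))\<^sup>2"
proof -
  obtain P where P: "P \<subseteq> G" "(\<Sum>n\<in>G. (norm (x n))\<^sup>2) \<le> (norm (sum x P - sum x (G - P)))\<^sup>2"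
    using exists_signs_norm_sum_ge[OF assms] by blast
  define F where "F = (if norm (sum x P) \<ge> norm (sum x (G - P)) then P else G - P)"
  have "norm (sum x P - sum x (G - P)) \<le> norm (sum x P) + norm (sum x (G - P))"
    by (rule norm_triangle_ineq4)
  also have "\<dots> \<le> 2 * norm (sum x F)"
    by (simp add: F_def)
  finally have "(norm (sum x P - sum x (G - P)))\<^sup>2 \<le> (2 * norm (sum x F))\<^sup>2"
    by (rule power_mono) simp
  moreover have "F \<subseteq> G"
    using P by (auto simp: F_def)
  ultimately show ?thesis
    using P order_trans by blast
qed

text \<open>Used to rearrange a single block \<open>B\<close> so that the positions \<open>A\<close>
  receive the chosen subset \<open>F\<close>: a bijection from \<open>A\<close> to \<open>F\<close>
  is glued to one between the complements.\<close>

lemma exists_bij_betw_image_eq: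
  assumes "finite B" "A \<subseteq> B" "F \<subseteq> B" "card A = card F"
  shows "\<exists>q. bij_betw q B B \<and> q ` A = F"
proof -
  have fin: "finite A" "finite F"
    using assms finite_subset by auto
  obtain f where f: "bij_betw f A F"
    using finite_same_card_bij fin assms by blast
  have "card (B - A) = card (B - F)"
    using assms fin by (simp add: card_Diff_subset)
  then obtain g where g: "bij_betw g (B - A) (B - F)"
    using finite_same_card_bij assms by blast
  let ?q = "\<lambda>n. if n \<in> A then f n else g n"
  have "bij_betw ?q A F"
    using f by (simp cong: bij_betw_cong)
  moreover have "bij_betw ?q (B - A) (B - F)"
    using g by (rule bij_betw_cong[THEN iffD1, rotated]) auto
  ultimately have "bij_betw ?q (A \<union> (B - A)) (F \<union> (B - F))"
    by (rule bij_betw_combine) auto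
  moreover have "A \<union> (B - A) = B" "F \<union> (B - F) = B"
    using assms by auto
  moreover have "?q ` A = F"
    using \<open>bij_betw ?q A F\<close> by (simp add: bij_betw_def)
  ultimately show ?thesis
    by (intro exI[of _ ?q]) simp
qed

text \<open>If \<open>\<Sum>n. (norm (x n))\<^sup>2\<close> diverges, the natural numbers split into consecutive blocks each of
  which contains a subset with a partial sum of norm at least 1. A permutation that moves these
  subsets to the front of their blocks destroys the Cauchy property.\<close>

theorem Orlicz:
  fixes x :: "nat \<Rightarrow> 'a::chilbert_space"
  assumes perm: "\<And>\<pi>. bij \<pi> \<Longrightarrow> summable (\<lambda>n. x (\<pi> n))"
  shows "summable (\<lambda>n. (norm (x n))\<^sup>2)"
proof (rule ccontr)
  assume not_summable: "\<not> summable (\<lambda>n. (norm (x n))\<^sup>2)"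
  \<comment> \<open>The threshold 4 offsets the factor 2 of the subset lemma, leaving a subset sum
    of norm at least 1. If no such \<open>M\<close> existed for some \<open>N\<close>, all partial
    sums would be bounded.\<close>
  have "\<exists>M>N. (\<Sum>n=N..<M. (norm (x n))\<^sup>2) \<ge> 4" for N
  proof (rule ccontr)
    assume *: "\<not> (\<exists>M>N. (\<Sum>n=N..<M. (norm (x n))\<^sup>2) \<ge> 4)"
    have "(\<Sum>n<M. (norm (x n))\<^sup>2) \<le> (\<Sum>n<N. (norm (x n))\<^sup>2) + 4" for M
    proof (cases "N < M")
      case True
      then have "(\<Sum>n<M. (norm (x n))\<^sup>2) = (\<Sum>n<N. (norm (x n))\<^sup>2) + (\<Sum>n=N..<M. (norm (x n))\<^sup>2)"
        using sum.atLeastLessThan_concat[of 0 N M "\<lambda>n. (norm (x n))\<^sup>2"]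
        by (simp add: atLeast0LessThan)
      then show ?thesis
        using * True by (auto simp: not_le)
    next
      case False
      then have "(\<Sum>n<M. (norm (x n))\<^sup>2) \<le> (\<Sum>n<N. (norm (x n))\<^sup>2)"
        by (intro sum_mono2) auto
      then show ?thesis by simp
    qed
    then have "summable (\<lambda>n. (norm (x n))\<^sup>2)"
      by (intro summableI_nonneg_bounded) auto
    with not_summable show False ..
  qed
  then obtain g where g: "\<And>N. N < g N" "\<And>N. (\<Sum>n=N..<g N. (norm (x n))\<^sup>2) \<ge> 4"
    by metis
  \<comment> \<open>Iterating \<open>g\<close> from 0 produces the left endpoints of the consecutive
    blocks.\<close>
  define b where "b k = (g ^^ k) 0" for k
  have b0: "b 0 = 0" and b_Suc: "b (Suc k) = g (b k)" for k
    by (simp_all add: b_def)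
  then have b: "strict_mono b"
    using g(1) by (simp add: strict_mono_Suc_iff)
  define I where "I k = {b k..<b (Suc k)}" for k
  have "\<exists>F\<subseteq>I k. 1 \<le> norm (sum x F)" for k
  proof -
    obtain F where "F \<subseteq> I k" "(\<Sum>n\<in>I k. (norm (x n))\<^sup>2) \<le> (2 * norm (sum x F))\<^sup>2"
      using exists_subset_norm_sum_ge[of "I k" x] by (auto simp: I_def)
    moreover have "2\<^sup>2 \<le> (\<Sum>n\<in>I k. (norm (x n))\<^sup>2)"
      using g(2) by (simp add: I_def b_Suc)
    ultimately have "2\<^sup>2 \<le> (2 * norm (sum x F))\<^sup>2"
      by linarith
    then have "2 \<le> 2 * norm (sum x F)"
      by (rule power2_le_imp_le) simp
    then have "1 \<le> norm (sum x F)"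
      by simp
    then show ?thesis
      using \<open>F \<subseteq> I k\<close> by blast
  qed
  then obtain F where F: "\<And>k. F k \<subseteq> I k" "\<And>k. 1 \<le> norm (sum x (F k))"
    by metis
  \<comment> \<open>The first \<open>card (F k)\<close> positions of the block form an interval,
    which is what the Cauchy criterion can test.\<close>
  define A where "A k = {b k..<b k + card (F k)}" for k
  have A: "A k \<subseteq> I k" "card (A k) = card (F k)" for k
    using card_mono[OF _ F(1), of k] by (auto simp: A_def I_def)
  have "\<exists>q. bij_betw q (I k) (I k) \<and> q ` A k = F k" for k
    by (rule exists_bij_betw_image_eq) (use A F in \<open>auto simp: I_def\<close>)
  then obtain q where q: "\<And>k. bij_betw (q k) (I k) (I k)" "\<And>k. q k ` A k = F k"
    by metis
  \<comment> \<open>The least \<open>k\<close> with \<open>n < b (Suc k)\<close> is the index of the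
    block containing \<open>n\<close>.\<close>
  define \<pi> where "\<pi> n = q (LEAST k. n < b (Suc k)) n" for n
  have idx: "(LEAST k. n < b (Suc k)) = k" if "n \<in> I k" for n k
  proof (rule Least_equality)
    show "n < b (Suc k)"
      using that by (simp add: I_def)
    fix j
    assume "n < b (Suc j)"
    then have "b k < b (Suc j)"
      using that by (simp add: I_def)
    then show "k \<le> j"
      using b by (simp add: strict_mono_less)
  qed
  have \<pi>_eq: "\<pi> n = q k n" if "n \<in> I k" for n k
    using idx that by (simp add: \<pi>_def)
  have disj: "disjoint_family_on I UNIV"
    unfolding disjoint_family_on_def using idx by (metis disjoint_iff)
  have cover: "(\<Union>k. I k) = UNIV"
  proof -
    have "\<exists>k. n \<in> I k" for n
    proof (induction n)
      case 0
      show ?case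
        using b0 b strict_monoD[OF b, of 0 1] by (auto simp: I_def intro!: exI[of _ 0])
    next
      case (Suc n)
      then obtain k where k: "n \<in> I k" by blast
      show ?case
      proof (cases "Suc n < b (Suc k)")
        case True
        then show ?thesis
          using k by (auto simp: I_def intro!: exI[of _ k])
      next
        case False
        then have "Suc n = b (Suc k)"
          using k by (auto simp: I_def)
        then show ?thesis
          using strict_monoD[OF b, of "Suc k" "Suc (Suc k)"]
          by (auto simp: I_def intro!: exI[of _ "Suc k"])
      qed
    qed
    then show ?thesis by auto
  qed
  have "bij_betw \<pi> (\<Union>k. I k) (\<Union>k. I k)"
    by (rule bij_betw_UNION_disjoint[OF disj])
      (use q(1) bij_betw_cong \<pi>_eq in metis)
  then have "summable (\<lambda>n. x (\<pi> n))"
    using perm cover by simp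
  then obtain N where N: "\<And>k n. k \<ge> N \<Longrightarrow> norm (\<Sum>i=k..<n. x (\<pi> i)) < 1"
    unfolding summable_Cauchy by (meson zero_less_one)
  have "(\<Sum>i\<in>A N. x (\<pi> i)) = (\<Sum>i\<in>A N. x (q N i))"
    using \<pi>_eq[OF subsetD[OF A(1)]] by (intro sum.cong) auto
  also have "\<dots> = sum x (F N)"
    using sum.reindex[OF inj_on_subset[OF bij_betw_imp_inj_on[OF q(1)] A(1)], of x N] q(2)
    by simp
  finally have "(\<Sum>i\<in>A N. x (\<pi> i)) = sum x (F N)" .
  \<comment> \<open>\<open>seq_suble\<close> gives \<open>N \<le> b N\<close>, so the Cauchy
    estimate applies to the interval \<open>A N\<close>, whose permuted sum has norm at least
    1.\<close>
  then show False
    using N[of "b N" "b N + card (F N)"] F(2)[of N] seq_suble[OF b, of N]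
    by (simp add: A_def)
qed

subsection \<open>Bessel sequences\<close>

lemma besselI:
  assumes "0 < B" "\<And>h N. (\<Sum>n<N. (cmod (cinner h (\<xi> n)))\<^sup>2) \<le> B * (norm h)\<^sup>2"
  shows "bessel \<xi>"
  unfolding bessel_def
proof (intro exI[of _ B] conjI allI)
  fix h
  show *: "summable (\<lambda>n. (cmod (cinner h (\<xi> n)))\<^sup>2)"
    using assms(2) by (intro summableI_nonneg_bounded) auto
  show "(\<Sum>n. (cmod (cinner h (\<xi> n)))\<^sup>2) \<le> B * (norm h)\<^sup>2"
    by (rule suminf_le_const[OF * assms(2)])
qed (use assms in auto)

text \<open>Arbitrary finite index sets, beyond initial segments, serve reindexing and the Cauchy
  criterion.\<close>

lemma besselE:
  assumes "bessel \<xi>"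
  obtains B where "0 < B"
    "\<And>h F. finite F \<Longrightarrow> (\<Sum>n\<in>F. (cmod (cinner h (\<xi> n)))\<^sup>2) \<le> B * (norm h)\<^sup>2"
proof -
  obtain B where B: "B > 0" "\<And>h. summable (\<lambda>n. (cmod (cinner h (\<xi> n)))\<^sup>2)"
    "\<And>h. (\<Sum>n. (cmod (cinner h (\<xi> n)))\<^sup>2) \<le> B * (norm h)\<^sup>2"
    using assms unfolding bessel_def by blast
  show thesis
    by (rule that[of B]) (use B in \<open>auto intro: order_trans[OF sum_le_suminf]\<close>)
qed

lemma bessel_imp_summable: "bessel \<xi> \<Longrightarrow> summable (\<lambda>n. (cmod (cinner h (\<xi> n)))\<^sup>2)"
  by (auto simp: bessel_def)

lemma bessel_reindex:
  assumes "bessel \<xi>" "inj \<pi>"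
  shows "bessel (\<lambda>n. \<xi> (\<pi> n))"
proof -
  obtain B where B: "0 < B"
    "\<And>h F. finite F \<Longrightarrow> (\<Sum>n\<in>F. (cmod (cinner h (\<xi> n)))\<^sup>2) \<le> B * (norm h)\<^sup>2"
    using besselE[OF assms(1)] by blast
  show ?thesis
  proof (rule besselI[OF B(1)])
    fix h N
    show "(\<Sum>n<N. (cmod (cinner h (\<xi> (\<pi> n))))\<^sup>2) \<le> B * (norm h)\<^sup>2"
      using B(2)[of "\<pi> ` {..<N}" h] assms(2)
      by (simp add: sum.reindex inj_on_subset[of \<pi> UNIV])
  qed
qed

text \<open>The seminorms are Euclidean norms of truncated coefficient vectors: Minkowski's
  inequality gives the triangle inequality, and square summability gives the pointwise
  bound.\<close>

lemma bessel_pointwiseI: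
  fixes \<xi> :: "nat \<Rightarrow> 'a::chilbert_space"
  assumes "\<And>h. summable (\<lambda>n. (cmod (cinner h (\<xi> n)))\<^sup>2)"
  shows "bessel \<xi>"
proof -
  define p where "p N h = L2_set (\<lambda>n. cmod (cinner h (\<xi> n))) {..<N}" for N h
  obtain C where C: "0 < C" "\<And>N x. p N x \<le> C * norm x"
  proof (rule uniform_boundedness_seminorms[of p])
    show "continuous_on UNIV (p N)" for N
      unfolding p_def L2_set_def by (intro continuous_intros)
    show "p N (x - y) \<le> p N x + p N y" for N x y
    proof -
      have "p N (x - y) \<le> L2_set (\<lambda>n. cmod (cinner x (\<xi> n)) + cmod (cinner y (\<xi> n))) {..<N}"
        unfolding p_def
        by (intro L2_set_mono) (auto simp: cinner_diff_left norm_triangle_ineq4)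
      also have "\<dots> \<le> p N x + p N y"
        unfolding p_def by (rule L2_set_triangle_ineq)
      finally show ?thesis .
    qed
    show "p N (r *\<^sub>R x) = \<bar>r\<bar> * p N x" for N r x
      by (simp add: p_def cinner_scaleR_left norm_mult L2_set_right_distrib)
    show "\<exists>C. \<forall>N. p N x \<le> C" for x
      unfolding p_def L2_set_def
      by (intro exI[of _ "sqrt (\<Sum>n. (cmod (cinner x (\<xi> n)))\<^sup>2)"])
        (auto intro!: sum_le_suminf assms)
  qed (rule that)
  show ?thesis
  proof (rule besselI)
    show "0 < C\<^sup>2"
      using C by simp
    fix h N
    have "(p N h)\<^sup>2 \<le> (C * norm h)\<^sup>2"
      by (rule power_mono[OF C(2)]) (simp add: p_def)
    then show "(\<Sum>n<N. (cmod (cinner h (\<xi> n)))\<^sup>2) \<le> C\<^sup>2 * (norm h)\<^sup>2"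
      by (simp add: p_def L2_set_def sum_nonneg power_mult_distrib)
  qed
qed

text \<open>Synthesis is adjoint to analysis and inherits its bound: expand
  \<open>cinner s s\<close>, apply Cauchy-Schwarz to the coefficients and cancel one factor
  \<open>norm s\<close>.\<close>

lemma norm_synthesis_le:
  fixes \<xi> :: "nat \<Rightarrow> 'a::complex_inner"
  assumes B: "\<And>h. (\<Sum>n\<in>F. (cmod (cinner h (\<xi> n)))\<^sup>2) \<le> B * (norm h)\<^sup>2" "0 \<le> B"
  shows "(norm (\<Sum>n\<in>F. c n *\<^sub>C \<xi> n))\<^sup>2 \<le> B * (\<Sum>n\<in>F. (cmod (c n))\<^sup>2)"
proof -
  define s where "s = (\<Sum>n\<in>F. c n *\<^sub>C \<xi> n)"
  let ?L = "L2_set (\<lambda>n. cmod (c n)) F"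
  have "cinner s s = (\<Sum>n\<in>F. c n * cinner (\<xi> n) s)"
    by (subst (1) s_def) (simp add: cinner_sum_left cinner_scaleC_left)
  then have "(norm s)\<^sup>2 = cmod (\<Sum>n\<in>F. c n * cinner (\<xi> n) s)"
    by (metis cinner_self norm_of_real abs_power2)
  also have "\<dots> \<le> (\<Sum>n\<in>F. \<bar>cmod (c n)\<bar> * \<bar>cmod (cinner s (\<xi> n))\<bar>)"
    by (intro sum_norm_le) (simp add: norm_mult cinner_commute[of s])
  also have "\<dots> \<le> ?L * L2_set (\<lambda>n. cmod (cinner s (\<xi> n))) F"
    by (rule L2_set_mult_ineq)
  also have "\<dots> \<le> ?L * (sqrt B * norm s)"
    using real_sqrt_le_mono[OF B(1)[of s]] by (intro mult_left_mono) (auto simp: L2_set_def real_sqrt_mult sum_nonneg)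
  finally have *: "norm s * norm s \<le> (sqrt B * ?L) * norm s"
    by (simp add: power2_eq_square ac_simps)
  have "norm s \<le> sqrt B * ?L"
    using * B(2) by (cases "s = 0") auto
  then have "(norm s)\<^sup>2 \<le> (sqrt B * ?L)\<^sup>2"
    by (rule power_mono) simp
  then show ?thesis
    using B(2) by (simp add: s_def L2_set_def power_mult_distrib sum_nonneg)
qed

text \<open>The bound on finite sums is left as a hypothesis to cover Bessel sequences as well as
  orthonormal ones, where Pythagoras supplies it with \<open>B = 1\<close>.\<close>

lemma summable_scaleC_Cauchy:
  fixes \<xi> :: "nat \<Rightarrow> 'a::chilbert_space"
  assumes c: "summable (\<lambda>n. (cmod (c n))\<^sup>2)" and B: "0 < B"
    and upper: "\<And>F. finite F \<Longrightarrow> (norm (\<Sum>n\<in>F. c n *\<^sub>C \<xi> n))\<^sup>2 \<le> B * (\<Sum>n\<in>F. (cmod (c n))\<^sup>2)"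
  shows "summable (\<lambda>n. c n *\<^sub>C \<xi> n)"
  unfolding summable_Cauchy
proof (intro allI impI)
  fix r :: real
  assume r: "0 < r"
  then have "0 < r\<^sup>2 / B"
    using B by simp
  then obtain N where N: "\<And>k n. k \<ge> N \<Longrightarrow> norm (\<Sum>i=k..<n. (cmod (c i))\<^sup>2) < r\<^sup>2 / B"
    using summable_Cauchy[THEN iffD1, OF c] by blast
  have "norm (\<Sum>i=k..<n. c i *\<^sub>C \<xi> i) < r" if "k \<ge> N" for k n
  proof (rule power2_less_imp_less)
    have "(norm (\<Sum>i=k..<n. c i *\<^sub>C \<xi> i))\<^sup>2 \<le> B * (\<Sum>i=k..<n. (cmod (c i))\<^sup>2)"
      by (rule upper) simp
    also have "\<dots> < r\<^sup>2"
      using N[OF that, of n] B by (simp add: sum_nonneg less_divide_eq mult.commute)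
    finally show "(norm (\<Sum>i=k..<n. c i *\<^sub>C \<xi> i))\<^sup>2 < r\<^sup>2" .
  qed (use r in simp)
  then show "\<exists>N. \<forall>k\<ge>N. \<forall>n. norm (\<Sum>i=k..<n. c i *\<^sub>C \<xi> i) < r"
    by blast
qed

lemma bessel_synthesis_summable:
  assumes "bessel \<xi>" "summable (\<lambda>n. (cmod (c n))\<^sup>2)"
  shows "summable (\<lambda>n. c n *\<^sub>C \<xi> n)"
proof -
  obtain B where B: "0 < B"
    "\<And>h F. finite F \<Longrightarrow> (\<Sum>n\<in>F. (cmod (cinner h (\<xi> n)))\<^sup>2) \<le> B * (norm h)\<^sup>2"
    using besselE[OF assms(1)] by blast
  show ?thesis
    by (rule summable_scaleC_Cauchy[OF assms(2) B(1)], rule norm_synthesis_le) (use B in auto)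
qed

lemma bessel_synthesis_permuted:
  assumes "bessel \<xi>" "summable (\<lambda>n. (cmod (c n))\<^sup>2)" "bij \<pi>"
  shows "summable (\<lambda>n. c (\<pi> n) *\<^sub>C \<xi> (\<pi> n))"
proof (rule bessel_synthesis_summable)
  show "bessel (\<lambda>n. \<xi> (\<pi> n))"
    using assms by (auto intro: bessel_reindex simp: bij_is_inj)
  show "summable (\<lambda>n. (cmod (c (\<pi> n)))\<^sup>2)"
    using summable_reindex[OF assms(2) bij_is_inj[OF assms(3)]] by (simp add: o_def)
qed

subsection \<open>Riesz bases\<close>

lemma riesz_basisE:
  assumes "riesz_basis \<Phi>"
  obtains A B where "0 < A" "0 < B"
    "\<And>c F. finite F \<Longrightarrow> A * (\<Sum>n\<in>F. (cmod (c n))\<^sup>2) \<le> (norm (\<Sum>n\<in>F. c n *\<^sub>C \<Phi> n))\<^sup>2"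
    "\<And>c F. finite F \<Longrightarrow> (norm (\<Sum>n\<in>F. c n *\<^sub>C \<Phi> n))\<^sup>2 \<le> B * (\<Sum>n\<in>F. (cmod (c n))\<^sup>2)"
proof -
  obtain A B where AB: "0 < A" "A \<le> B" "\<And>c. summable (\<lambda>n. (cmod (c n))\<^sup>2) \<Longrightarrow>
      A * (\<Sum>n. (cmod (c n))\<^sup>2) \<le> (norm (\<Sum>n. c n *\<^sub>C \<Phi> n))\<^sup>2 \<and>
      (norm (\<Sum>n. c n *\<^sub>C \<Phi> n))\<^sup>2 \<le> B * (\<Sum>n. (cmod (c n))\<^sup>2)"
    using assms unfolding riesz_basis_def by blast
  have *: "A * (\<Sum>n\<in>F. (cmod (c n))\<^sup>2) \<le> (norm (\<Sum>n\<in>F. c n *\<^sub>C \<Phi> n))\<^sup>2 \<and>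
      (norm (\<Sum>n\<in>F. c n *\<^sub>C \<Phi> n))\<^sup>2 \<le> B * (\<Sum>n\<in>F. (cmod (c n))\<^sup>2)"
    if "finite F" for c F
  proof -
    \<comment> \<open>Extension by zero turns the series in the Riesz inequalities into sums over
      \<open>F\<close>.\<close>
    define c' where "c' n = (if n \<in> F then c n else 0)" for n
    have "(\<Sum>n. (cmod (c' n))\<^sup>2) = (\<Sum>n\<in>F. (cmod (c' n))\<^sup>2)"
      "(\<Sum>n. c' n *\<^sub>C \<Phi> n) = (\<Sum>n\<in>F. c' n *\<^sub>C \<Phi> n)"
      by (intro suminf_finite that; simp add: c'_def)+
    moreover have "summable (\<lambda>n. (cmod (c' n))\<^sup>2)"
      by (intro summable_finite[OF that]) (simp add: c'_def)
    ultimately show ?thesis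
      using AB(3)[of c'] by (simp add: c'_def)
  qed
  show thesis
    by (rule that[of A B]) (use AB * in auto)
qed

text \<open>Dual to \<open>norm_synthesis_le\<close>: with coefficients
  \<open>cinner h (\<Phi> n)\<close> the square sum \<open>S\<close> equals
  \<open>cinner h s\<close>, while the upper Riesz bound gives
  \<open>(norm s)\<^sup>2 \<le> B * S\<close>; one factor \<open>S\<close> cancels.\<close>

lemma riesz_basis_imp_bessel:
  assumes "riesz_basis \<Phi>"
  shows "bessel \<Phi>"
proof -
  obtain A B where B: "0 < B"
    "\<And>c F. finite F \<Longrightarrow> (norm (\<Sum>n\<in>F. c n *\<^sub>C \<Phi> n))\<^sup>2 \<le> B * (\<Sum>n\<in>F. (cmod (c n))\<^sup>2)"
    using riesz_basisE[OF assms] by metis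
  show ?thesis
  proof (rule besselI[OF B(1)])
    fix h N
    define s where "s = (\<Sum>n<N. cinner h (\<Phi> n) *\<^sub>C \<Phi> n)"
    define S where "S = (\<Sum>n<N. (cmod (cinner h (\<Phi> n)))\<^sup>2)"
    have S: "S \<ge> 0"
      by (simp add: S_def sum_nonneg)
    have "cinner h s = complex_of_real S"
      by (simp add: s_def S_def cinner_sum_right cinner_scaleC_right complex_norm_square mult.commute
          del: of_real_power)
    then have "S \<le> norm h * norm s"
      using cinner_Cauchy_Schwarz[of h s] S by simp
    then have "S\<^sup>2 \<le> (norm h)\<^sup>2 * (norm s)\<^sup>2"
      using power_mono[OF _ S, of "norm h * norm s" 2] by (simp add: power_mult_distrib)
    also have "\<dots> \<le> (norm h)\<^sup>2 * (B * S)"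
      using B(2)[of "{..<N}"] by (intro mult_left_mono) (auto simp: s_def S_def)
    finally have "S * S \<le> (B * (norm h)\<^sup>2) * S"
      by (simp add: power2_eq_square ac_simps)
    then show "S \<le> B * (norm h)\<^sup>2"
      using S B(1) by (cases "S = 0") auto
  qed
qed

lemma riesz_basis_imp_norm_bounded_below:
  assumes "riesz_basis \<Phi>"
  shows "norm_bounded_below \<Phi>"
proof -
  obtain A where A: "0 < A"
    "\<And>c F. finite F \<Longrightarrow> A * (\<Sum>n\<in>F. (cmod (c n))\<^sup>2) \<le> (norm (\<Sum>n\<in>F. c n *\<^sub>C \<Phi> n))\<^sup>2"
    using riesz_basisE[OF assms] by metis
  \<comment> \<open>This is the lower Riesz bound for the single coefficient 1 at index
    \<open>n\<close>.\<close>
  have "sqrt A \<le> norm (\<Phi> n)" for n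
    using A(2)[of "{n}" "\<lambda>_. 1"] by (simp add: real_le_lsqrt norm_scaleC)
  then have "sqrt A \<le> (INF n. norm (\<Phi> n))"
    by (intro cINF_greatest) auto
  then show ?thesis
    unfolding norm_bounded_below_def using A by (meson less_le_trans real_sqrt_gt_zero)
qed

lemma norm_bounded_belowE:
  assumes "norm_bounded_below \<Phi>"
  obtains a where "0 < a" "\<And>n. a \<le> norm (\<Phi> n)"
proof (rule that)
  show "0 < (INF n. norm (\<Phi> n))"
    using assms by (simp add: norm_bounded_below_def)
  show "(INF n. norm (\<Phi> n)) \<le> norm (\<Phi> n)" for n
    by (rule cINF_lower) (auto intro!: bdd_belowI[of _ 0])
qed

text \<open>Partial sums of a convergent series are bounded, and the lower Riesz bound passes this
  on to the partial sums of the squared coefficients.\<close>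

lemma riesz_basis_coeff_summable:
  assumes "riesz_basis \<Phi>" "summable (\<lambda>n. c n *\<^sub>C \<Phi> n)"
  shows "summable (\<lambda>n. (cmod (c n))\<^sup>2)"
proof -
  obtain A where A: "0 < A"
    "\<And>c F. finite F \<Longrightarrow> A * (\<Sum>n\<in>F. (cmod (c n))\<^sup>2) \<le> (norm (\<Sum>n\<in>F. c n *\<^sub>C \<Phi> n))\<^sup>2"
    using riesz_basisE[OF assms(1)] by metis
  obtain K where K: "\<And>N. norm (\<Sum>n<N. c n *\<^sub>C \<Phi> n) \<le> K"
    using convergent_imp_Bseq[OF summable_iff_convergent[THEN iffD1, OF assms(2)]]
    by (auto simp: Bseq_def)
  have "(\<Sum>n<N. (cmod (c n))\<^sup>2) \<le> K\<^sup>2 / A" for N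
    using A(2)[of "{..<N}" c] power_mono[OF K[of N] norm_ge_zero, of 2] A(1)
    by (simp add: le_divide_eq mult.commute)
  then show ?thesis
    by (intro summableI_nonneg_bounded) auto
qed

subsection \<open>Multipliers\<close>

text \<open>Conjugate-linearity in the second argument turns \<open>m\<close> into
  \<open>cnj m\<close>; Bessel sums see only the modulus.\<close>

lemma cmod_cinner_scaleC: "cmod (cinner f (m *\<^sub>C x)) = cmod (m * cinner f x)"
  by (simp add: cinner_scaleC_right norm_mult)

lemma unconditionally_convergent_imp_well_defined:
  "multiplier_unconditionally_convergent m \<Phi> \<Psi> \<Longrightarrow> multiplier_well_defined m \<Phi> \<Psi>"
  unfolding multiplier_unconditionally_convergent_def multiplier_well_defined_def
  using bij_id by (metis (no_types, lifting) ext id_apply)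

section \<open>Sufficiency of the Bessel condition on \<open>m n *\<^sub>C \<Psi> n\<close>\<close>

lemma bessel_imp_unconditionally_convergent:
  assumes "bessel \<Phi>" "bessel (\<lambda>n. m n *\<^sub>C \<Psi> n)"
  shows "multiplier_unconditionally_convergent m \<Phi> \<Psi>"
  unfolding multiplier_unconditionally_convergent_def multiplier_term_def
proof (intro allI impI)
  fix f and \<pi> :: "nat \<Rightarrow> nat"
  assume "bij \<pi>"
  then show "summable (\<lambda>n. (m (\<pi> n) * cinner f (\<Psi> (\<pi> n))) *\<^sub>C \<Phi> (\<pi> n))"
    using bessel_imp_summable[OF assms(2), of f]
    by (intro bessel_synthesis_permuted[OF assms(1), of "\<lambda>n. m n * cinner f (\<Psi> n)"])
      (simp_all add: cmod_cinner_scaleC)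
qed

text \<open>The two Bessel hypotheses exchange roles: \<open>\<Phi>\<close> now supplies the
  coefficients, and the weights \<open>m\<close> are absorbed into the synthesised vectors.\<close>

lemma bessel_imp_unconditionally_convergent_swap:
  assumes "bessel \<Phi>" "bessel (\<lambda>n. m n *\<^sub>C \<Psi> n)"
  shows "multiplier_unconditionally_convergent m \<Psi> \<Phi>"
  unfolding multiplier_unconditionally_convergent_def multiplier_term_def
proof (intro allI impI)
  fix f and \<pi> :: "nat \<Rightarrow> nat"
  assume "bij \<pi>"
  then show "summable (\<lambda>n. (m (\<pi> n) * cinner f (\<Phi> (\<pi> n))) *\<^sub>C \<Psi> (\<pi> n))"
    using bessel_synthesis_permuted[OF assms(2) bessel_imp_summable[OF assms(1)]]
    by (simp add: scaleC_scaleC mult.commute)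
qed

section \<open>Necessity of the Bessel condition\<close>

lemma unconditionally_convergent_imp_bessel:
  assumes "norm_bounded_below \<Phi>" "multiplier_unconditionally_convergent m \<Phi> \<Psi>"
  shows "bessel (\<lambda>n. m n *\<^sub>C \<Psi> n)"
proof (rule bessel_pointwiseI)
  fix f
  obtain a where a: "0 < a" "\<And>n. a \<le> norm (\<Phi> n)"
    using norm_bounded_belowE[OF assms(1)] by blast
  \<comment> \<open>Each term has norm
    \<open>cmod (m n * cinner f (\<Psi> n)) * norm (\<Phi> n)\<close>; dividing the squares by
    \<open>a\<^sup>2\<close> compensates for the last factor.\<close>
  have "summable (\<lambda>n. (norm (multiplier_term m \<Phi> \<Psi> f n))\<^sup>2)"
    using assms(2) by (intro Orlicz) (simp add: multiplier_unconditionally_convergent_def)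
  then have "summable (\<lambda>n. (norm (multiplier_term m \<Phi> \<Psi> f n))\<^sup>2 / a\<^sup>2)"
    by (rule summable_divide)
  then show "summable (\<lambda>n. (cmod (cinner f (m n *\<^sub>C \<Psi> n)))\<^sup>2)"
  proof (rule summable_comparison_test'[where N = 0], goal_cases)
    case (1 n)
    have "cmod (cinner f (m n *\<^sub>C \<Psi> n)) * a \<le> norm (multiplier_term m \<Phi> \<Psi> f n)"
      using a by (simp add: multiplier_term_def norm_scaleC cmod_cinner_scaleC mult_left_mono)
    then have "(cmod (cinner f (m n *\<^sub>C \<Psi> n)) * a)\<^sup>2 \<le> (norm (multiplier_term m \<Phi> \<Psi> f n))\<^sup>2"
      using a by (intro power_mono) auto
    then show ?case
      using a by (simp add: le_divide_eq power_mult_distrib)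
  qed
qed

text \<open>The series is an expansion in a Riesz basis, so its coefficients are square summable as
  soon as it converges in the given order.\<close>

lemma well_defined_imp_bessel:
  assumes "riesz_basis \<Phi>" "multiplier_well_defined m \<Phi> \<Psi>"
  shows "bessel (\<lambda>n. m n *\<^sub>C \<Psi> n)"
proof (rule bessel_pointwiseI)
  fix f
  show "summable (\<lambda>n. (cmod (cinner f (m n *\<^sub>C \<Psi> n)))\<^sup>2)"
    using riesz_basis_coeff_summable[OF assms(1), of "\<lambda>n. m n * cinner f (\<Psi> n)"] assms(2)
    by (simp add: cmod_cinner_scaleC multiplier_well_defined_def multiplier_term_def [abs_def])
qed

text \<open>For fixed \<open>h\<close>, the numbers \<open>\<langle>S\<^sub>N f, h\<rangle>\<close>, where \<open>S\<^sub>N f\<close> denotes the partial sums of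
  \<open>M\<^bsub>m,\<Psi>,\<Phi>\<^esub> f\<close>, are values at \<open>f\<close> of the functionals represented by \<open>y N\<close> below. Uniform
  boundedness bounds \<open>norm (y N)\<close>, and the lower Riesz bound turns this into square summability.\<close>

lemma well_defined_swap_imp_bessel:
  assumes "riesz_basis \<Phi>" "multiplier_well_defined m \<Psi> \<Phi>"
  shows "bessel (\<lambda>n. m n *\<^sub>C \<Psi> n)"
proof (rule bessel_pointwiseI)
  fix h
  obtain A where A: "0 < A"
    "\<And>c F. finite F \<Longrightarrow> A * (\<Sum>n\<in>F. (cmod (c n))\<^sup>2) \<le> (norm (\<Sum>n\<in>F. c n *\<^sub>C \<Phi> n))\<^sup>2"
    using riesz_basisE[OF assms(1)] by metis
  define c where "c n = cinner h (m n *\<^sub>C \<Psi> n)" for n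
  define y where "y N = (\<Sum>n<N. c n *\<^sub>C \<Phi> n)" for N
  have "bounded (range (\<lambda>N. cinner f (y N)))" for f
  proof -
    let ?S = "\<lambda>N. \<Sum>n<N. multiplier_term m \<Psi> \<Phi> f n"
    have "Bseq ?S"
      using assms(2) unfolding multiplier_well_defined_def
      by (intro convergent_imp_Bseq summable_iff_convergent[THEN iffD1]) auto
    then obtain K where K: "\<And>N. norm (?S N) \<le> K"
      by (auto simp: Bseq_def)
    \<comment> \<open>Since \<open>cnj (c n) = m n * cinner (\<Psi> n) h\<close>, both sides are
      sums of \<open>m n * cinner f (\<Phi> n) * cinner (\<Psi> n) h\<close>.\<close>
    have "cinner f (y N) = cinner (?S N) h" for N
      by (simp add: y_def c_def cinner_sum_right cinner_sum_left cinner_scaleC_right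
          cinner_scaleC_left multiplier_term_def cinner_commute[of h] ac_simps)
    then have "cmod (cinner f (y N)) \<le> K * norm h" for N
      using order_trans[OF cinner_Cauchy_Schwarz mult_right_mono[OF K norm_ge_zero]] by simp
    then show ?thesis
      by (auto simp: bounded_iff)
  qed
  then have "bounded (range y)"
    by (rule uniform_boundedness_functionals)
  then obtain K where K: "\<And>N. norm (y N) \<le> K"
    by (auto simp: bounded_iff)
  have "(\<Sum>n<N. (cmod (c n))\<^sup>2) \<le> K\<^sup>2 / A" for N
    using A(2)[of "{..<N}" c] power_mono[OF K[of N] norm_ge_zero, of 2] A(1)
    by (simp add: y_def le_divide_eq mult.commute)
  then show "summable (\<lambda>n. (cmod (cinner h (m n *\<^sub>C \<Psi> n)))\<^sup>2)"
    by (intro summableI_nonneg_bounded) (auto simp: c_def)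
qed

section \<open>Boundedness of the symbol \<open>m\<close>\<close>

lemma bessel_imp_bounded:
  assumes "bessel \<xi>"
  shows "bounded (range \<xi>)"
proof -
  obtain B where B: "0 < B"
    "\<And>h F. finite F \<Longrightarrow> (\<Sum>n\<in>F. (cmod (cinner h (\<xi> n)))\<^sup>2) \<le> B * (norm h)\<^sup>2"
    using besselE[OF assms] by blast
  have "norm (\<xi> n) \<le> sqrt B" for n
  proof (cases "\<xi> n = 0")
    case False
    \<comment> \<open>The Bessel inequality for the single index \<open>n\<close> is tested at
      \<open>h = \<xi> n\<close>.\<close>
    have "(norm (\<xi> n))\<^sup>2 * (norm (\<xi> n))\<^sup>2 \<le> B * (norm (\<xi> n))\<^sup>2"
      using B(2)[of "{n}" "\<xi> n"]
      by (simp add: cinner_self norm_mult power2_eq_square)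
    then have "(norm (\<xi> n))\<^sup>2 \<le> B"
      by (rule mult_right_le_imp_le) (use False in simp)
    then show ?thesis
      by (rule real_le_rsqrt)
  qed (use B in auto)
  then show ?thesis
    by (auto simp: bounded_iff)
qed

text \<open>The weighted vectors are bounded in norm, and the lower bound on
  \<open>norm (\<Psi> n)\<close> transfers this to \<open>m n\<close>.\<close>

lemma bessel_scaleC_imp_bounded:
  assumes "bessel (\<lambda>n. m n *\<^sub>C \<Psi> n)" "norm_bounded_below \<Psi>"
  shows "bounded (range m)"
proof -
  obtain a where a: "0 < a" "\<And>n. a \<le> norm (\<Psi> n)"
    using norm_bounded_belowE[OF assms(2)] by blast
  obtain K where K: "\<And>n. norm (m n *\<^sub>C \<Psi> n) \<le> K"
    using bessel_imp_bounded[OF assms(1)] by (auto simp: bounded_iff)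
  have "cmod (m n) \<le> K / a" for n
    using a(1) order_trans[OF mult_left_mono[OF a(2) norm_ge_zero] K[unfolded norm_scaleC], of n]
    by (simp add: le_divide_eq)
  then show ?thesis
    by (auto simp: bounded_iff)
qed

lemma bessel_scaleC_bounded:
  assumes "bessel \<Psi>" "bounded (range m)"
  shows "bessel (\<lambda>n. m n *\<^sub>C \<Psi> n)"
proof (rule bessel_pointwiseI)
  fix h
  obtain K where K: "\<And>n. cmod (m n) \<le> K"
    using assms(2) by (auto simp: bounded_iff)
  have "summable (\<lambda>n. K\<^sup>2 * (cmod (cinner h (\<Psi> n)))\<^sup>2)"
    by (intro summable_mult bessel_imp_summable assms)
  then show "summable (\<lambda>n. (cmod (cinner h (m n *\<^sub>C \<Psi> n)))\<^sup>2)"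
    by (rule summable_comparison_test'[where N = 0])
      (auto simp: cmod_cinner_scaleC norm_mult power_mult_distrib intro!: mult_right_mono power_mono K)
qed

subsection \<open>Orthonormal bases\<close>

text \<open>One Gram-Schmidt step: \<open>r\<close> is the normalised residual of \<open>x\<close>
  after projection onto the span of the \<open>e i\<close>.\<close>

lemma exists_unit_vector_orthogonal:
  fixes e :: "'i \<Rightarrow> 'a::complex_inner"
  assumes fin: "finite I"
    and norm: "\<And>i. i \<in> I \<Longrightarrow> norm (e i) = 1"
    and orth: "\<And>i j. i \<in> I \<Longrightarrow> j \<in> I \<Longrightarrow> i \<noteq> j \<Longrightarrow> cinner (e i) (e j) = 0"
    and x: "x \<notin> cspan (e ` I)"
  shows "\<exists>r. norm r = 1 \<and> (\<forall>i\<in>I. cinner r (e i) = 0) \<and> x \<in> cspan (insert r (e ` I))"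
proof -
  define P where "P = (\<Sum>i\<in>I. cinner x (e i) *\<^sub>C e i)"
  define z where "z = x - P"
  define r where "r = complex_of_real (inverse (norm z)) *\<^sub>C z"
  have P: "P \<in> cspan (e ` I)"
    unfolding P_def
    by (intro complex_vector.span_sum complex_vector.span_scale complex_vector.span_base) auto
  then have z: "z \<noteq> 0"
    using x by (auto simp: z_def)
  have "cinner z (e j) = 0" if "j \<in> I" for j
  proof -
    have "cinner P (e j) = (\<Sum>i\<in>I. if i = j then cinner x (e j) else 0)"
      unfolding P_def cinner_sum_left
      using that norm orth by (intro sum.cong) (auto simp: cinner_scaleC_left cinner_self)
    then show ?thesis
      using that fin by (simp add: z_def cinner_diff_left)
  qed
  then have "\<forall>i\<in>I. cinner r (e i) = 0"
    by (simp add: r_def cinner_scaleC_left)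
  moreover have "norm r = 1"
    using z by (simp add: r_def norm_scaleC norm_inverse)
  moreover have "x \<in> cspan (insert r (e ` I))"
  proof -
    have "x = complex_of_real (norm z) *\<^sub>C r + P"
      using z by (simp add: r_def z_def scaleC_scaleC scaleC_one flip: of_real_mult)
    moreover have "complex_of_real (norm z) *\<^sub>C r \<in> cspan (insert r (e ` I))"
      by (intro complex_vector.span_scale complex_vector.span_base) auto
    moreover have "P \<in> cspan (insert r (e ` I))"
      using P complex_vector.span_mono[of "e ` I" "insert r (e ` I)"] by auto
    ultimately show ?thesis
      by (metis complex_vector.span_add)
  qed
  ultimately show ?thesis
    by blast
qed

text \<open>Gram-Schmidt runs along an enumeration \<open>d\<close> of a countable dense set; stage
  \<open>n\<close> puts \<open>d n\<close> into the span, which makes the span dense.\<close>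

lemma exists_orthonormal_basis:
  assumes separable: "separable_space (euclidean :: 'a::complex_inner topology)"
    and infinite_dimensional: "\<not> (\<exists>S :: 'a set. finite S \<and> cspan S = UNIV)"
  shows "\<exists>e :: nat \<Rightarrow> 'a. (\<forall>n. norm (e n) = 1) \<and> (\<forall>i j. i \<noteq> j \<longrightarrow> cinner (e i) (e j) = 0) \<and>
    closure (cspan (range e)) = UNIV"
proof -
  obtain D :: "'a set" where D: "countable D" "closure D = UNIV"
    using separable by (auto simp: separable_space_def)
  then have "D \<noteq> {}"
    by auto
  define d where "d = from_nat_into D"
  have d: "range d = D"
    using D \<open>D \<noteq> {}\<close> by (simp add: d_def range_from_nat_into)
  define Q where "Q e n r \<longleftrightarrow> norm r = 1 \<and> (\<forall>i<n. cinner r (e i) = 0) \<and>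
    d n \<in> cspan (insert r (e ` {..<n}))" for e :: "nat \<Rightarrow> 'a" and n r
  have "\<exists>e. \<forall>n. Q e n (e n)"
  proof (rule dependent_wellorder_choice)
    \<comment> \<open>The recursion requires that \<open>Q e n\<close> depend only on the values of
      \<open>e\<close> below \<open>n\<close>.\<close>
    fix r :: 'a and e e' :: "nat \<Rightarrow> 'a" and n
    assume *: "\<And>i. i < n \<Longrightarrow> e i = e' i"
    then have "e ` {..<n} = e' ` {..<n}"
      by (auto intro!: image_cong)
    with * show "Q e n r = Q e' n r"
      by (simp add: Q_def)
  next
    fix n and e :: "nat \<Rightarrow> 'a"
    assume e: "\<And>i. i < n \<Longrightarrow> Q e i (e i)"
    then have orth: "cinner (e i) (e j) = 0" if "i < n" "j < n" "i \<noteq> j" for i j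
      using that cinner_commute[of "e i" "e j"] by (cases "i < j") (auto simp: Q_def)
    \<comment> \<open>If \<open>d n\<close> already lies in the span it yields no new direction;
      infinite dimension then provides some other vector outside, so every index receives a unit
      vector.\<close>
    obtain x where x: "x \<notin> cspan (e ` {..<n})"
      "d n \<in> cspan (e ` {..<n}) \<or> x = d n"
      using infinite_dimensional by (metis UNIV_eq_I finite_imageI finite_lessThan)
    obtain r where r: "norm r = 1" "\<forall>i\<in>{..<n}. cinner r (e i) = 0"
      "x \<in> cspan (insert r (e ` {..<n}))"
      using exists_unit_vector_orthogonal[OF _ _ _ x(1)] e orth by (auto simp: Q_def)
    moreover have "d n \<in> cspan (insert r (e ` {..<n}))"
      using x(2) r(3) complex_vector.span_mono[of "e ` {..<n}" "insert r (e ` {..<n})"] by auto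
    ultimately show "\<exists>r. Q e n r"
      by (auto simp: Q_def)
  qed
  then obtain e where e: "\<And>n. Q e n (e n)"
    by blast
  have "d n \<in> cspan (range e)" for n
    using e[of n] complex_vector.span_mono[of "insert (e n) (e ` {..<n})" "range e"]
    by (auto simp: Q_def)
  then have "D \<subseteq> cspan (range e)"
    using d by auto
  then have "closure (cspan (range e)) = UNIV"
    using D closure_mono by (metis top.extremum_uniqueI)
  moreover have "cinner (e i) (e j) = 0" if "i \<noteq> j" for i j
    using that e[of i] e[of j] cinner_commute[of "e i" "e j"] by (cases "i < j") (auto simp: Q_def)
  moreover have "norm (e n) = 1" for n
    using e[of n] by (simp add: Q_def)
  ultimately show ?thesis
    by blast
qed

text \<open>Pythagoras for finite sums passes to the limit as Parseval's identity, so both Riesz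
  constants can be 1.\<close>

lemma orthonormal_basis_imp_riesz_basis:
  fixes e :: "nat \<Rightarrow> 'a::chilbert_space"
  assumes norm: "\<And>n. norm (e n) = 1"
    and orth: "\<And>i j. i \<noteq> j \<Longrightarrow> cinner (e i) (e j) = 0"
    and dense: "closure (cspan (range e)) = UNIV"
  shows "riesz_basis e"
proof -
  have Pythagoras: "(norm (\<Sum>n\<in>F. c n *\<^sub>C e n))\<^sup>2 = (\<Sum>n\<in>F. (cmod (c n))\<^sup>2)" if "finite F" for F c
    using that
  proof (induction F)
    case (insert a F)
    have "cinner (e a) (e n) = 0" if "n \<in> F" for n
      using insert that by (intro orth) auto
    then have "cinner (c a *\<^sub>C e a) (\<Sum>n\<in>F. c n *\<^sub>C e n) = 0"
      by (simp add: cinner_sum_right cinner_scaleC_left cinner_scaleC_right)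
    then show ?case
      using insert by (simp add: norm_add_sq norm_scaleC norm)
  qed simp
  show ?thesis
    unfolding riesz_basis_def
  proof (intro conjI exI[of _ "1::real"] allI impI dense)
    fix c :: "nat \<Rightarrow> complex"
    assume c: "summable (\<lambda>n. (cmod (c n))\<^sup>2)"
    show *: "summable (\<lambda>n. c n *\<^sub>C e n)"
      by (rule summable_scaleC_Cauchy[OF c, of 1]) (simp_all add: Pythagoras)
    have "(\<lambda>N. (norm (\<Sum>n<N. c n *\<^sub>C e n))\<^sup>2) \<longlonglongrightarrow> (norm (\<Sum>n. c n *\<^sub>C e n))\<^sup>2"
      by (intro tendsto_intros summable_LIMSEQ *)
    moreover have "(\<lambda>N. (norm (\<Sum>n<N. c n *\<^sub>C e n))\<^sup>2) \<longlonglongrightarrow> (\<Sum>n. (cmod (c n))\<^sup>2)"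
      using summable_LIMSEQ[OF c] by (simp add: Pythagoras)
    ultimately have "(norm (\<Sum>n. c n *\<^sub>C e n))\<^sup>2 = (\<Sum>n. (cmod (c n))\<^sup>2)"
      by (rule LIMSEQ_unique)
    then show "1 * (\<Sum>n. (cmod (c n))\<^sup>2) \<le> (norm (\<Sum>n. c n *\<^sub>C e n))\<^sup>2"
      "(norm (\<Sum>n. c n *\<^sub>C e n))\<^sup>2 \<le> 1 * (\<Sum>n. (cmod (c n))\<^sup>2)"
      by simp_all
  qed simp_all
qed

text \<open>At \<open>h = x\<close> the Bessel series has constant nonzero terms.\<close>

lemma not_bessel_const:
  fixes x :: "'a::chilbert_space"
  assumes "x \<noteq> 0"
  shows "\<not> bessel (\<lambda>n. x)"
  using bessel_imp_summable[of "\<lambda>n. x" x] assms by (auto simp: cinner_self summable_const_iff)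

theorem proposition3p9:
  fixes \<Phi> \<Psi> :: "nat \<Rightarrow> 'a::chilbert_space" and m :: "nat \<Rightarrow> complex"
  assumes separable: "separable_space (euclidean :: 'a topology)"
    and infinite_dimensional: "\<not> (\<exists>S :: 'a set. finite S \<and> cspan S = UNIV)"
  shows
    "(norm_bounded_below \<Phi> \<and> bessel \<Phi> \<longrightarrow>
       (multiplier_unconditionally_convergent m \<Phi> \<Psi> \<longleftrightarrow> bessel (\<lambda>n. m n *\<^sub>C \<Psi> n))) \<and>
     (riesz_basis \<Phi> \<longrightarrow>
       (multiplier_well_defined m \<Phi> \<Psi> \<longleftrightarrow> multiplier_unconditionally_convergent m \<Phi> \<Psi>) \<and>
       (multiplier_unconditionally_convergent m \<Phi> \<Psi> \<longleftrightarrow> bessel (\<lambda>n. m n *\<^sub>C \<Psi> n)) \<and>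
       (bessel (\<lambda>n. m n *\<^sub>C \<Psi> n) \<longleftrightarrow> multiplier_well_defined m \<Psi> \<Phi>) \<and>
       (multiplier_well_defined m \<Psi> \<Phi> \<longleftrightarrow> multiplier_unconditionally_convergent m \<Psi> \<Phi>)) \<and>
     ((riesz_basis \<Phi> \<and> norm_bounded_below \<Psi> \<and>
         (multiplier_well_defined m \<Phi> \<Psi> \<or> multiplier_well_defined m \<Psi> \<Phi>) \<longrightarrow>
         bounded (range m)) \<and>
      (\<exists>(\<Phi>' :: nat \<Rightarrow> 'a) (\<Psi>' :: nat \<Rightarrow> 'a) (m' :: nat \<Rightarrow> complex).
         riesz_basis \<Phi>' \<and> norm_bounded_below \<Psi>' \<and> bounded (range m') \<and>
         \<not> multiplier_well_defined m' \<Phi>' \<Psi>' \<and> \<not> multiplier_well_defined m' \<Psi>' \<Phi>')) \<and>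
     (riesz_basis \<Phi> \<and> riesz_basis \<Psi> \<longrightarrow>
       (multiplier_well_defined m \<Phi> \<Psi> \<longleftrightarrow> bounded (range m)))"
proof -
  obtain e :: "nat \<Rightarrow> 'a" where e: "\<And>n. norm (e n) = 1" "riesz_basis e"
    using exists_orthonormal_basis[OF assms] orthonormal_basis_imp_riesz_basis by metis
  \<comment> \<open>The scalar 1 is kept to match the shape \<open>m n *\<^sub>C \<Psi> n\<close>
    for the constant symbol 1.\<close>
  have not_bessel: "\<not> bessel (\<lambda>n. 1 *\<^sub>C e 0)"
    using e(1)[of 0] by (intro not_bessel_const) (auto simp: scaleC_one)
  have "\<exists>(\<Phi>' :: nat \<Rightarrow> 'a) (\<Psi>' :: nat \<Rightarrow> 'a) (m' :: nat \<Rightarrow> complex).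
      riesz_basis \<Phi>' \<and> norm_bounded_below \<Psi>' \<and> bounded (range m') \<and>
      \<not> multiplier_well_defined m' \<Phi>' \<Psi>' \<and> \<not> multiplier_well_defined m' \<Psi>' \<Phi>'"
  proof (intro exI conjI)
    show "riesz_basis e" by fact
    show "norm_bounded_below (\<lambda>n. e 0)" "bounded (range (\<lambda>n. 1))"
      using e(1) by (simp_all add: norm_bounded_below_def)
    show "\<not> multiplier_well_defined (\<lambda>n. 1) e (\<lambda>n. e 0)"
      using well_defined_imp_bessel[OF e(2)] not_bessel by blast
    show "\<not> multiplier_well_defined (\<lambda>n. 1) (\<lambda>n. e 0) e"
      using well_defined_swap_imp_bessel[OF e(2)] not_bessel by blast
  qed
  moreover have "multiplier_unconditionally_convergent m \<Phi> \<Psi> \<longleftrightarrow> bessel (\<lambda>n. m n *\<^sub>C \<Psi> n)"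
    if "norm_bounded_below \<Phi>" "bessel \<Phi>"
    using that bessel_imp_unconditionally_convergent unconditionally_convergent_imp_bessel by blast
  \<comment> \<open>Every convergence statement is compared with the Bessel property alone; the
    remaining equivalences and the bound on \<open>m\<close> then follow by chaining.\<close>
  moreover have
    "multiplier_well_defined m \<Phi> \<Psi> \<longleftrightarrow> bessel (\<lambda>n. m n *\<^sub>C \<Psi> n)"
    "multiplier_unconditionally_convergent m \<Phi> \<Psi> \<longleftrightarrow> bessel (\<lambda>n. m n *\<^sub>C \<Psi> n)"
    "multiplier_well_defined m \<Psi> \<Phi> \<longleftrightarrow> bessel (\<lambda>n. m n *\<^sub>C \<Psi> n)"
    "multiplier_unconditionally_convergent m \<Psi> \<Phi> \<longleftrightarrow> bessel (\<lambda>n. m n *\<^sub>C \<Psi> n)"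
    if "riesz_basis \<Phi>"
    using that riesz_basis_imp_bessel[OF that] bessel_imp_unconditionally_convergent
      bessel_imp_unconditionally_convergent_swap unconditionally_convergent_imp_well_defined
      well_defined_imp_bessel well_defined_swap_imp_bessel by blast+
  moreover have "bounded (range m)"
    if "bessel (\<lambda>n. m n *\<^sub>C \<Psi> n)" "norm_bounded_below \<Psi>"
    using that by (rule bessel_scaleC_imp_bounded)
  \<comment> \<open>A Riesz basis is both Bessel, which gives the implication from right to left,
    and norm-bounded below, which gives the other.\<close>
  moreover have "bessel (\<lambda>n. m n *\<^sub>C \<Psi> n) \<longleftrightarrow> bounded (range m)" if "riesz_basis \<Psi>"
    using bessel_scaleC_bounded[OF riesz_basis_imp_bessel[OF that]]
      bessel_scaleC_imp_bounded[OF _ riesz_basis_imp_norm_bounded_below[OF that]] by blast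
  ultimately show ?thesis
    by (intro conjI impI; (elim conjE)?; simp; blast)
qed

end
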